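(* Let $V(x)=\tanh(x-2)-\tanh(-2)$, let $\bar v\in(0,1+\tanh 2)$ and $X_\infty=V^{-1}(\bar v)>0$, and let $(X_{1,\circ},Y_{1,\circ})\in(0,X_\infty)\times(0,\infty)$. Then there exist $\alpha_0,\beta_0>0$ such that for all $\alpha\ge\alpha_0$ and $\beta\ge\beta_0$ the solution $(X_1,Y_1)$ of $$\dot X_1=Y_1,\qquad \dot Y_1=-\alpha\{V(X_1)-\bar v\}-\alpha Y_1-\beta\,\frac{Y_1}{X_1^2},\qquad (X_1(0),Y_1(0))=(X_{1,\circ},Y_{1,\circ}),$$ satisfies $$\limsup_{t\nearrow\mathcal T_\infty}Y_1(t)=0,$$ where $\mathcal T_\infty=\inf\{t\ge 0: X_1(t)=X_\infty\}\in(0,\infty]$ (with $\inf\emptyset=\infty$).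
   Context: This is the optimal velocity follow-the-leader model for two vehicles: the lead vehicle moves with constant velocity $\bar v$, $X_1$ is the distance between the two vehicles and $Y_1=\dot X_1$. The state space is $(0,\infty)\times\mathbb R$. For $\alpha,\beta>0$ the solution is known to exist for all $t\ge0$ and to satisfy $X_1(t)\ge\delta_1>0$ for all $t\ge 0$, for some $\delta_1$ depending on the initial data. The function $V:\mathbb R\to\mathbb R$ is strictly increasing with $V(0)=0$ and $\lim_{x\to\infty}V(x)=1+\tanh 2$; $(X_\infty,0)$ is the unique equilibrium. *)

theory Defs
  imports "HOL-Analysis.Analysis"
begin

definition opt_vel :: "real \<Rightarrow> real" where
  "opt_vel x = tanh (x - 2) - tanh (- 2)"

text \<open>\<open>opt_vel\<close> is strictly increasing, so for \<open>vbar\<close> in its range, in particular for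
  \<open>0 < vbar < 1 + tanh 2\<close>, this is the unique preimage of \<open>vbar\<close>.\<close>

definition X_eq :: "real \<Rightarrow> real" where
  "X_eq vbar = inv opt_vel vbar"

text \<open>Global forward solutions in the state space \<open>{0<..} \<times> UNIV\<close>; the derivatives are
  one-sided at \<open>t = 0\<close>, and values at negative times are irrelevant.\<close>

definition ftl_solution ::
  "real \<Rightarrow> real \<Rightarrow> real \<Rightarrow> real \<Rightarrow> real \<Rightarrow> (real \<Rightarrow> real) \<Rightarrow> (real \<Rightarrow> real) \<Rightarrow> bool" where
  "ftl_solution \<alpha> \<beta> vbar X0 Y0 X Y \<longleftrightarrow>
     X 0 = X0 \<and> Y 0 = Y0 \<and>
     (\<forall>t\<ge>0. X t > 0 \<and>
        (X has_real_derivative Y t) (at t within {0..}) \<and>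
        (Y has_real_derivative
           (- \<alpha> * (opt_vel (X t) - vbar) - \<alpha> * Y t - \<beta> * (Y t / (X t)\<^sup>2))) (at t within {0..}))"

definition hit_time :: "real \<Rightarrow> (real \<Rightarrow> real) \<Rightarrow> ereal" where
  "hit_time x X = Inf {ereal t | t. 0 \<le> t \<and> X t = x}"

end

theory Submission
  imports Defs
begin

text \<open>
  Put \<open>u = X_eq vbar - X\<close>. For \<open>k \<ge> 2\<close> with \<open>Y0 < k * (X_eq vbar - X0)\<close> and \<open>\<alpha> \<ge> k\<^sup>2\<close> the
  solution never leaves the region \<open>0 < Y < k * u\<close>: on the line \<open>Y = k * u\<close> the damping term
  \<open>\<alpha> * Y\<close> beats \<open>\<alpha> * (vbar - opt_vel X) \<le> \<alpha> * u\<close>, because \<open>opt_vel\<close> is 1-Lipschitz. Then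
  \<open>u' \<ge> - k * u\<close>, so \<open>u\<close> stays positive and the hitting time is infinite. Finally
  \<open>Z = Y + \<alpha> * X - \<beta> / X\<close> is bounded above with \<open>Z' = \<alpha> * (vbar - opt_vel X)\<close>; this forces the
  decreasing function \<open>u\<close>, and hence \<open>Y < k * u\<close>, to tend to 0.
\<close>

section \<open>Monotonicity and a first-zero argument on the half-line, with one-sided derivatives
  at 0\<close>

lemma nondecreasing_Ici:
  fixes f f' :: "real \<Rightarrow> real"
  assumes "0 \<le> a" "a \<le> b"
    and der: "\<And>t. a \<le> t \<Longrightarrow> t \<le> b \<Longrightarrow> (f has_real_derivative f' t) (at t within {0..})"
    and nonneg: "\<And>t. a < t \<Longrightarrow> t < b \<Longrightarrow> 0 \<le> f' t"
  shows "f a \<le> f b"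
proof (rule DERIV_nonneg_imp_increasing_open[OF \<open>a \<le> b\<close>])
  fix t assume t: "a < t" "t < b"
  then have "at t within {0..} = at t"
    using \<open>0 \<le> a\<close> by (intro at_within_interior) auto
  then show "\<exists>y. (f has_real_derivative y) (at t) \<and> 0 \<le> y"
    using der[of t] nonneg[of t] t by auto
next
  have "(f has_real_derivative f' t) (at t within {a..b})" if "t \<in> {a..b}" for t
    using der[of t] that \<open>0 \<le> a\<close> by (auto intro: DERIV_subset)
  then show "continuous_on {a..b} f"
    by (rule DERIV_continuous_on)
qed

text \<open>A barrier argument: a function that starts positive reaches its first zero from above,
  so it cannot have a positive derivative there. The sign of \<open>f'\<close> therefore has to be
  checked only at a first zero, with positivity at all earlier times available.\<close>

lemma pos_if_increasing_at_first_zero: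
  fixes f f' :: "real \<Rightarrow> real"
  assumes "0 < f 0"
    and der: "\<And>t. 0 \<le> t \<Longrightarrow> (f has_real_derivative f' t) (at t within {0..})"
    and zero: "\<And>t. 0 < t \<Longrightarrow> (\<And>s. 0 \<le> s \<Longrightarrow> s < t \<Longrightarrow> 0 < f s) \<Longrightarrow> f t = 0 \<Longrightarrow> 0 < f' t"
    and "0 \<le> T"
  shows "0 < f T"
proof (rule ccontr)
  assume "\<not> 0 < f T"
  have cont: "continuous_on {0..T} f"
  proof (rule DERIV_continuous_on)
    show "(f has_real_derivative f' t) (at t within {0..T})" if "t \<in> {0..T}" for t
      using der[of t] that by (auto intro: DERIV_subset)
  qed
  define S where "S = {0..T} \<inter> f -` {..0}"
  have "closed S"
    unfolding S_def using cont by (intro continuous_closed_preimage) auto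
  then have "compact S"
    unfolding S_def by (meson bounded_Int bounded_closed_interval compact_eq_bounded_closed)
  moreover have "S \<noteq> {}"
    using \<open>\<not> 0 < f T\<close> \<open>0 \<le> T\<close> by (auto simp: S_def)
  ultimately obtain t where t: "t \<in> S" "\<And>s. s \<in> S \<Longrightarrow> t \<le> s"
    using compact_attains_inf[of S] by blast
  have before: "0 < f s" if "0 \<le> s" "s < t" for s
    using t that unfolding S_def by force
  have "0 < t"
    using t(1) \<open>0 < f 0\<close> by (cases "t = 0") (auto simp: S_def)
  \<comment> \<open>Membership in \<open>S\<close> gives only \<open>f t \<le> 0\<close>; the
    intermediate value theorem excludes a strict inequality, as it would put a zero before
    \<open>t\<close>.\<close>
  have "\<exists>x\<ge>0. x \<le> t \<and> f x = 0"
    using t(1) \<open>0 < f 0\<close>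
    by (intro IVT2' continuous_on_subset[OF cont]) (auto simp: S_def)
  then have "f t = 0"
    using before by (metis less_irrefl order_le_less)
  have "0 < f' t"
    using zero[OF \<open>0 < t\<close> before \<open>f t = 0\<close>] .
  then obtain d where d: "d > 0" "\<And>h. 0 < h \<Longrightarrow> t - h \<in> {0..} \<Longrightarrow> h < d \<Longrightarrow> f (t - h) < f t"
    using has_real_derivative_pos_inc_left[OF der[of t]] \<open>0 < t\<close> by auto
  \<comment> \<open>Half of \<open>d\<close> makes \<open>h < d\<close> strict, and
    \<open>h \<le> t\<close> keeps \<open>t - h\<close> in the half-line.\<close>
  define h where "h = min t (d / 2)"
  have "f (t - h) < f t" "0 < f (t - h)"
    using d \<open>0 < t\<close> before[of "t - h"] by (auto simp: h_def min_def)
  then show False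
    using \<open>f t = 0\<close> by simp
qed

section \<open>The optimal velocity function and its inverse\<close>

lemma opt_vel_less_iff [simp]: "opt_vel x < opt_vel y \<longleftrightarrow> x < y"
  by (simp add: opt_vel_def)

lemma opt_vel_le_iff [simp]: "opt_vel x \<le> opt_vel y \<longleftrightarrow> x \<le> y"
  by (simp add: opt_vel_def)

text \<open>The derivative of \<open>x - opt_vel x\<close> is a square, since tanh' = 1 -
  tanh^2.\<close>

lemma opt_vel_diff_le:
  assumes "a \<le> b"
  shows "opt_vel b - opt_vel a \<le> b - a"
proof -
  have "a - opt_vel a \<le> b - opt_vel b"
  proof (rule DERIV_nonneg_imp_nondecreasing[OF assms])
    fix x :: real
    have "cosh (x - 2) \<noteq> 0"
      by (metis cosh_real_pos less_irrefl)
    then have "((\<lambda>x. x - opt_vel x) has_real_derivative (tanh (x - 2))\<^sup>2) (at x)"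
      unfolding opt_vel_def by (auto intro!: derivative_eq_intros)
    then show "\<exists>y. ((\<lambda>x. x - opt_vel x) has_real_derivative y) (at x) \<and> 0 \<le> y"
      by auto
  qed
  then show ?thesis by simp
qed

text \<open>As \<open>X_eq\<close> is defined through \<open>inv\<close>, \<open>vbar\<close> must
  be shown to lie in the range of \<open>opt_vel\<close>. The explicit preimage is 2 + artanh y,
  with artanh y written as \<open>ln q\<close>.\<close>

lemma opt_vel_X_eq:
  assumes "0 < vbar" "vbar < 1 + tanh 2"
  shows "opt_vel (X_eq vbar) = vbar"
proof -
  define y where "y = vbar - tanh (2::real)"
  define q where "q = sqrt ((1 + y) / (1 - y))"
  have y: "-1 < y" "y < 1"
    using assms tanh_real_lt_1[of 2] by (auto simp: y_def)
  then have "q > 0" "q\<^sup>2 = (1 + y) / (1 - y)"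
    by (auto simp: q_def)
  moreover have "q\<^sup>2 + 1 = 2 / (1 - y)" "q\<^sup>2 - 1 = 2 * y / (1 - y)"
    using y \<open>q\<^sup>2 = _\<close> by (auto simp: field_simps)
  ultimately have "tanh (ln q) = y"
    using y by (simp add: tanh_ln_real)
  then have "opt_vel (ln q + 2) = vbar"
    by (simp add: opt_vel_def y_def)
  then show ?thesis
    unfolding X_eq_def by (metis f_inv_into_f rangeI)
qed

section \<open>The invariant region and the infinite hitting time\<close>

context
  fixes \<alpha> \<beta> vbar X0 Y0 k :: real and X Y :: "real \<Rightarrow> real"
  assumes vbar: "0 < vbar" "vbar < 1 + tanh 2"
    and X0: "X0 < X_eq vbar" and Y0: "0 < Y0"
    and k: "2 \<le> k" "Y0 < k * (X_eq vbar - X0)"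
    and \<alpha>: "k\<^sup>2 \<le> \<alpha>" and \<beta>: "0 < \<beta>"
    and sol: "ftl_solution \<alpha> \<beta> vbar X0 Y0 X Y"
begin

lemma \<alpha>_pos: "0 < \<alpha>"
  using k(1) \<alpha> by (smt (verit) zero_less_power)

lemma initial: "X 0 = X0" "Y 0 = Y0"
  using sol by (auto simp: ftl_solution_def)

lemma X_pos: "0 \<le> t \<Longrightarrow> 0 < X t"
  using sol by (simp add: ftl_solution_def)

lemma X_deriv: "0 \<le> t \<Longrightarrow> (X has_real_derivative Y t) (at t within {0..})"
  using sol by (simp add: ftl_solution_def)

lemma Y_deriv:
  "0 \<le> t \<Longrightarrow> (Y has_real_derivative
     (\<alpha> * (vbar - opt_vel (X t)) - \<alpha> * Y t - \<beta> * (Y t / (X t)\<^sup>2))) (at t within {0..})"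
  using sol by (simp add: ftl_solution_def algebra_simps)

text \<open>Gronwall's argument with integrating factor \<open>exp (k * s)\<close>. The bound on
  \<open>Y\<close> is assumed only before \<open>t\<close>, so that the lemma applies at a first
  contact with the line Y = k * u, where the bound itself fails.\<close>

lemma X_less_X_eq_if:
  assumes "0 \<le> t" and below: "\<And>s. 0 \<le> s \<Longrightarrow> s < t \<Longrightarrow> Y s < k * (X_eq vbar - X s)"
  shows "X t < X_eq vbar"
proof -
  define g where "g = (\<lambda>s. (X_eq vbar - X s) * exp (k * s))"
  have "g 0 \<le> g t"
  proof (rule nondecreasing_Ici[where f = g])
    show "(g has_real_derivative (k * (X_eq vbar - X s) - Y s) * exp (k * s)) (at s within {0..})"
      if "0 \<le> s" for s
      unfolding g_def using that
      by (auto intro!: derivative_eq_intros X_deriv simp: algebra_simps)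
    show "0 \<le> (k * (X_eq vbar - X s) - Y s) * exp (k * s)" if "0 < s" "s < t" for s
      using below[of s] that by simp
  qed (use assms in auto)
  moreover have "0 < g 0"
    using X0 by (simp add: g_def initial)
  ultimately have "0 < g t"
    by simp
  then show ?thesis
    by (simp add: g_def zero_less_mult_iff)
qed

lemma Y_less:
  assumes "0 \<le> t"
  shows "Y t < k * (X_eq vbar - X t)"
proof -
  define f where "f = (\<lambda>t. k * (X_eq vbar - X t) - Y t)"
  define f' where "f' = (\<lambda>t. - k * Y t
    - (\<alpha> * (vbar - opt_vel (X t)) - \<alpha> * Y t - \<beta> * (Y t / (X t)\<^sup>2)))"
  have "0 < f t"
  proof (rule pos_if_increasing_at_first_zero[where f = f and f' = f'])
    show "0 < f 0"
      using k by (simp add: f_def initial)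
    show "(f has_real_derivative f' t) (at t within {0..})" if "0 \<le> t" for t
      unfolding f_def f'_def using that
      by (auto intro!: derivative_eq_intros X_deriv Y_deriv)
    show "0 < f' t"
      if t: "0 < t" and before: "\<And>s. 0 \<le> s \<Longrightarrow> s < t \<Longrightarrow> 0 < f s" and "f t = 0" for t
    proof -
      define u where "u = X_eq vbar - X t"
      have "0 < u"
        using X_less_X_eq_if[of t] t before by (auto simp: u_def f_def)
      have Y: "Y t = k * u"
        using \<open>f t = 0\<close> by (simp add: f_def u_def)
      have "vbar - opt_vel (X t) \<le> u"
        using opt_vel_diff_le[of "X t" "X_eq vbar"] opt_vel_X_eq[OF vbar] \<open>0 < u\<close>
        by (simp add: u_def)
      then have "\<alpha> * (vbar - opt_vel (X t)) \<le> \<alpha> * u"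
        using \<alpha>_pos by simp
      \<comment> \<open>Damping dominates drive plus the motion of the line: k \<ge> 2 gives 2 *
        \<alpha> \<le> \<alpha> * k, and one of the two copies of \<alpha> absorbs k^2.\<close>
      moreover have "\<alpha> * u + k * (k * u) \<le> \<alpha> * (k * u)"
      proof -
        have "\<alpha> * 1 \<le> \<alpha> * (k - 1)"
          using \<alpha>_pos k(1) by (intro mult_left_mono) auto
        then have "\<alpha> + k * k \<le> \<alpha> * k"
          using \<alpha> by (auto simp: power2_eq_square algebra_simps)
        then have "(\<alpha> + k * k) * u \<le> \<alpha> * k * u"
          using \<open>0 < u\<close> by simp
        then show ?thesis
          by (simp add: algebra_simps)
      qed
      moreover have "0 < \<beta> * (Y t / (X t)\<^sup>2)"
        using \<beta> k(1) \<open>0 < u\<close> X_pos[of t] t by (simp add: Y)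
      ultimately show ?thesis
        unfolding f'_def Y by simp
    qed
  qed (use assms in auto)
  then show ?thesis
    by (simp add: f_def)
qed

lemma X_less_X_eq: "0 \<le> t \<Longrightarrow> X t < X_eq vbar"
  using X_less_X_eq_if Y_less by simp

text \<open>At a zero of \<open>Y\<close> both damping terms vanish, and the remaining drive is
  positive because \<open>X\<close> is below equilibrium.\<close>

lemma Y_pos:
  assumes "0 \<le> t"
  shows "0 < Y t"
  using _ Y_deriv _ assms
proof (rule pos_if_increasing_at_first_zero[where f = Y])
  show "0 < Y 0"
    using Y0 by (simp add: initial)
  fix t assume "0 < t" "Y t = 0"
  have "opt_vel (X t) < vbar"
    using X_less_X_eq[of t] \<open>0 < t\<close> opt_vel_X_eq[OF vbar] by (metis less_imp_le opt_vel_less_iff)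
  then show "0 < \<alpha> * (vbar - opt_vel (X t)) - \<alpha> * Y t - \<beta> * (Y t / (X t)\<^sup>2)"
    using \<open>Y t = 0\<close> \<alpha>_pos by simp
qed

lemma X_mono:
  assumes "0 \<le> s" "s \<le> t"
  shows "X s \<le> X t"
  using assms
  by (intro nondecreasing_Ici[where f = X and f' = Y]) (auto intro!: X_deriv less_imp_le[OF Y_pos])

lemma hit_time_eq_infinity: "hit_time (X_eq vbar) X = \<infinity>"
proof -
  have "{ereal t |t. 0 \<le> t \<and> X t = X_eq vbar} = {}"
    using X_less_X_eq by force
  then show ?thesis
    unfolding hit_time_def by (simp only: Inf_empty top_ereal_def)
qed

section \<open>Convergence to the equilibrium\<close>

lemma X_approaches_X_eq:
  assumes "0 < e"
  shows "\<exists>T\<ge>0. X_eq vbar - e < X T"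
proof (rule ccontr)
  assume "\<not> ?thesis"
  then have far: "X t \<le> X_eq vbar - e" if "0 \<le> t" for t
    using that by force
  \<comment> \<open>If \<open>X\<close> stays \<open>e\<close> below equilibrium, monotonicity of
    \<open>opt_vel\<close> makes \<open>c\<close> a lower bound for the derivative of
    \<open>Z\<close>.\<close>
  define c where "c = \<alpha> * (vbar - opt_vel (X_eq vbar - e))"
  have "opt_vel (X_eq vbar - e) < vbar"
    using assms opt_vel_X_eq[OF vbar] by (metis diff_less_eq less_add_same_cancel1 opt_vel_less_iff)
  then have "0 < c"
    using \<alpha>_pos by (simp add: c_def)
  \<comment> \<open>The terms \<alpha> * X and -\<beta> / X are antiderivatives of the two damping
    terms along the solution, so only the drive remains in the derivative of
    \<open>Z\<close>.\<close>
  define Z where "Z = (\<lambda>t. Y t + \<alpha> * X t - \<beta> / X t)"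
  define B where "B = k * (X_eq vbar - X0) + \<alpha> * X_eq vbar"
  have Z_upper: "Z t \<le> B" if "0 \<le> t" for t
  proof -
    have "Y t \<le> k * (X_eq vbar - X0)"
      using Y_less[OF that] X_mono[of 0 t] that k(1)
      by (smt (verit) initial(1) mult_left_mono)
    moreover have "\<alpha> * X t \<le> \<alpha> * X_eq vbar"
      using X_less_X_eq[OF that] \<alpha>_pos by simp
    moreover have "0 \<le> \<beta> / X t"
      using X_pos[OF that] \<beta> by simp
    ultimately show ?thesis
      by (simp add: Z_def B_def)
  qed
  have Z_lower: "Z 0 + c * t \<le> Z t" if "0 \<le> t" for t
  proof -
    have "Z 0 - c * 0 \<le> Z t - c * t"
    proof (rule nondecreasing_Ici[where f = "\<lambda>s. Z s - c * s"])
      show "((\<lambda>s. Z s - c * s) has_real_derivative \<alpha> * (vbar - opt_vel (X s)) - c) (at s within {0..})"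
        if "0 \<le> s" for s
        unfolding Z_def using that X_pos[OF that]
        by (auto intro!: derivative_eq_intros X_deriv Y_deriv simp: power2_eq_square)
      show "0 \<le> \<alpha> * (vbar - opt_vel (X s)) - c" if "0 < s" for s
        using far[of s] that \<alpha>_pos by (simp add: c_def)
    qed (use that in auto)
    then show ?thesis by simp
  qed
  \<comment> \<open>A time at which the linear lower bound \<open>Z 0 + c * t\<close> exceeds
    \<open>B\<close>.\<close>
  define t where "t = (\<bar>B - Z 0\<bar> + 1) / c"
  have "0 \<le> t" "c * t = \<bar>B - Z 0\<bar> + 1"
    using \<open>0 < c\<close> by (auto simp: t_def)
  then show False
    using Z_upper[of t] Z_lower[of t] by linarith
qed

lemma Y_tendsto_0: "(Y \<longlongrightarrow> 0) at_top"
proof (rule tendstoI)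
  fix e :: real assume "0 < e"
  then obtain T where T: "0 \<le> T" "X_eq vbar - e / k < X T"
    using X_approaches_X_eq[of "e / k"] k(1) by auto
  have "dist (Y t) 0 < e" if "T \<le> t" for t
  proof -
    have "X_eq vbar - X t < e / k"
      using X_mono[of T t] T that by linarith
    then have "k * (X_eq vbar - X t) < e"
      using k(1) by (simp add: field_simps)
    then show ?thesis
      using Y_less[of t] Y_pos[of t] T(1) that by simp
  qed
  then show "\<forall>\<^sub>F t in at_top. dist (Y t) 0 < e"
    by (auto simp: eventually_at_top_linorder)
qed

text \<open>In the extended reals \<open>at_left \<infinity>\<close> is the image of
  \<open>at_top\<close> under \<open>ereal\<close>, so the real limit carries over; this filter is
  nontrivial, hence the limit is also the Limsup.\<close>

lemma Limsup_Y_at_left_infinity: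
  "Limsup (at_left \<infinity>) (\<lambda>t. ereal (Y (real_of_ereal t))) = 0"
proof (rule lim_imp_Limsup)
  have "((\<lambda>t. ereal (Y t)) \<longlongrightarrow> ereal 0) at_top"
    using Y_tendsto_0 by (simp only: lim_ereal)
  then show "((\<lambda>t. ereal (Y (real_of_ereal t))) \<longlongrightarrow> 0) (at_left \<infinity>)"
    by (simp add: at_left_PInf filterlim_filtermap zero_ereal_def)
qed (simp add: at_left_PInf filtermap_bot_iff)

end

theorem mainTheorem2:
  fixes vbar X0 Y0 :: real
  assumes "0 < vbar" and "vbar < 1 + tanh 2"
    and "0 < X0" and "X0 < X_eq vbar"
    and "0 < Y0"
  shows "\<exists>\<alpha>0 > 0. \<exists>\<beta>0 > 0. \<forall>\<alpha> \<ge> \<alpha>0. \<forall>\<beta> \<ge> \<beta>0. \<forall>X Y.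
           ftl_solution \<alpha> \<beta> vbar X0 Y0 X Y \<longrightarrow>
             0 < hit_time (X_eq vbar) X \<and>
             Limsup (at_left (hit_time (X_eq vbar) X)) (\<lambda>t. ereal (Y (real_of_ereal t))) = 0"
proof -
  \<comment> \<open>The quotient makes k * u at time 0 reach \<open>Y0\<close>; adding 2 makes the
    inequality strict and ensures k \<ge> 2. The thresholds are then \<open>k\<^sup>2\<close> for
    \<alpha> and 1 for \<beta>.\<close>
  define k where "k = Y0 / (X_eq vbar - X0) + 2"
  have "2 \<le> k"
    using assms by (simp add: k_def)
  have "k * (X_eq vbar - X0) = Y0 + 2 * (X_eq vbar - X0)"
    using assms by (simp add: k_def distrib_right)
  then have "Y0 < k * (X_eq vbar - X0)"
    using assms by simp
  note k = \<open>2 \<le> k\<close> this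
  have "0 < hit_time (X_eq vbar) X \<and>
      Limsup (at_left (hit_time (X_eq vbar) X)) (\<lambda>t. ereal (Y (real_of_ereal t))) = 0"
    if "k\<^sup>2 \<le> \<alpha>" "1 \<le> \<beta>" "ftl_solution \<alpha> \<beta> vbar X0 Y0 X Y" for \<alpha> \<beta> X Y
  proof -
    have "0 < \<beta>"
      using \<open>1 \<le> \<beta>\<close> by simp
    note args = assms(1,2,4,5) k that(1) this that(3)
    show ?thesis
      using hit_time_eq_infinity[OF args] Limsup_Y_at_left_infinity[OF args] by simp
  qed
  moreover have "0 < k\<^sup>2"
    using k(1) by simp
  ultimately show ?thesis
    by (metis zero_less_one)
qed

end
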